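(* For each integer $n\ge 0$, let $RR_1(n)$ denote the number of partitions of $n$ in which the difference between any two parts is at least $2$, and let $\overline{RR_1}(n)$ denote the number of overpartitions of $n$ in which the non-overlined parts are odd and distinct, and every overlined part is at most the number of non-overlined parts. Then $RR_1(n)=\overline{RR_1}(n)$ for every $n\ge 0$.
   Context: A partition of $n$ is a weakly decreasing finite sequence of positive integers (its parts) with sum $n$; parts at different positions count as different parts, so "difference at least $2$" excludes repeated parts. An overpartition of $n$ is a weakly decreasing finite sequence of positive integers with sum $n$ in which the last occurrence of a part of each given magnitude may or may not be overlined. Thus the overlined parts are automatically distinct from one another. "The non-overlined parts are distinct" means that they are pairwise distinct among themselves; an overlined and a non-overlined part may have the same magnitude. Conditions on parts of a given kind are vacuous if there are no such parts. There is exactly one partition and one overpartition of $0$ (the empty one). *)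

theory Defs
  imports Main
begin

definition partitions :: "nat \<Rightarrow> nat list set" where
  "partitions n = {xs. sorted_wrt (\<ge>) xs \<and> (\<forall>x\<in>set xs. 0 < x) \<and> sum_list xs = n}"

text \<open>A part of an overpartition is a pair of its magnitude and a flag telling whether it is
  overlined. The second conjunct below says that an overlined part is never followed by a part of
  the same magnitude, i.e. that only the last occurrence of each magnitude may be overlined.\<close>

type_synonym opart = "nat \<times> bool"

definition overpartitions :: "nat \<Rightarrow> opart list set" where
  "overpartitions n = {ps. sorted_wrt (\<lambda>p q. fst p \<ge> fst q) ps
     \<and> sorted_wrt (\<lambda>p q. snd p \<longrightarrow> fst p \<noteq> fst q) ps
     \<and> (\<forall>p\<in>set ps. 0 < fst p) \<and> sum_list (map fst ps) = n}"

definition overlined :: "opart list \<Rightarrow> nat list" where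
  "overlined ps = map fst (filter snd ps)"

definition non_overlined :: "opart list \<Rightarrow> nat list" where
  "non_overlined ps = map fst (filter (\<lambda>p. \<not> snd p) ps)"

text \<open>Since partitions are decreasing, the gap condition only has to look at a part and the parts
  after it; it is written additively to avoid truncated subtraction.\<close>

definition RR1 :: "nat \<Rightarrow> nat" where
  "RR1 n = card {xs \<in> partitions n. sorted_wrt (\<lambda>x y. x \<ge> y + 2) xs}"

definition RR1_bar :: "nat \<Rightarrow> nat" where
  "RR1_bar n = card {ps \<in> overpartitions n.
     (\<forall>x\<in>set (non_overlined ps). odd x) \<and> distinct (non_overlined ps)
     \<and> (\<forall>x\<in>set (overlined ps). x \<le> length (non_overlined ps))}"

text \<open>Both cardinalities are of finite sets.\<close>

lemma length_le_sum_list: "\<forall>x\<in>set xs. 0 < x \<Longrightarrow> length xs \<le> sum_list (xs :: nat list)"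
  by (induction xs) auto

lemma finite_partitions: "finite (partitions n)"
proof (rule finite_subset)
  show "partitions n \<subseteq> {xs. set xs \<subseteq> {..n} \<and> length xs \<le> n}"
    unfolding partitions_def by (auto dest: length_le_sum_list member_le_sum_list)
qed (simp add: finite_lists_length_le)

lemma finite_overpartitions: "finite (overpartitions n)"
proof (rule finite_subset)
  show "overpartitions n \<subseteq> {ps. set ps \<subseteq> {..n} \<times> UNIV \<and> length ps \<le> n}"
  proof
    fix ps assume "ps \<in> overpartitions n"
    then have pos: "\<forall>x\<in>set (map fst ps). 0 < x" and sum: "sum_list (map fst ps) = n"
      unfolding overpartitions_def by auto
    have "length ps \<le> n"
      using length_le_sum_list[OF pos] sum by simp
    moreover have "fst p \<le> n" if "p \<in> set ps" for p
      using member_le_sum_list[of "fst p" "map fst ps"] that sum by auto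
    ultimately show "ps \<in> {ps. set ps \<subseteq> {..n} \<times> UNIV \<and> length ps \<le> n}"
      by (auto simp: mem_Times_iff)
  qed
qed (simp add: finite_lists_length_le)

end

theory Submission
  imports Defs
begin

text \<open>A partition \<open>y\<^sub>1, \<dots>, y\<^sub>m\<close> with differences at least 2 is determined by the amounts
  by which its gaps exceed the least possible ones: \<open>d\<^sub>i = y\<^sub>i - y\<^sub>i\<^sub>+\<^sub>1 - 2\<close> for \<open>i < m\<close> and
  \<open>d\<^sub>m = y\<^sub>m - 1\<close>, which are arbitrary natural numbers. Raising \<open>d\<^sub>i\<close> by one raises the parts
  \<open>y\<^sub>1, \<dots>, y\<^sub>i\<close> by one each, so the sum of the partition is \<open>m\<^sup>2 + \<Sum> i d\<^sub>i\<close>.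

  Now split \<open>d\<^sub>i = 2 a\<^sub>i + b\<^sub>i\<close> with \<open>b\<^sub>i \<in> {0, 1}\<close>. The even excesses \<open>2 a\<^sub>i\<close> belong to a
  partition with \<open>m\<close> parts, all of them odd and distinct, and every such partition arises once,
  because two distinct odd numbers differ by an even number that is at least 2. The remaining
  weight \<open>\<Sum> i b\<^sub>i\<close> is the sum of the set \<open>{i. b\<^sub>i = 1}\<close>, an arbitrary subset of \<open>{1..m}\<close>. The
  former partition supplies the non-overlined parts and the latter set the overlined ones. In
  terms of generating functions this is
  \<open>q\<^sup>m\<^sup>*\<^sup>m / (q;q)\<^sub>m = (-q;q)\<^sub>m q\<^sup>m\<^sup>*\<^sup>m / (q\<^sup>2;q\<^sup>2)\<^sub>m\<close>.

  The lemmas \<open>bij_betw_from_gaps\<close> and \<open>bij_betw_split_parity\<close> carry these two steps. What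
  remains is that an overpartition of the required kind is the same as the pair of its
  non-overlined parts and its set of overlined parts (\<open>bij_betw_split_overpartition\<close>).\<close>

section \<open>Partitions with differences at least 2 and their excess gaps\<close>

text \<open>The head of the result is the largest part: it exceeds the least possible value
  \<open>2 * length ds + 1\<close> by all the excesses together.\<close>

fun from_gaps :: "nat list \<Rightarrow> nat list" where
  "from_gaps [] = []"
| "from_gaps (d # ds) = (2 * length ds + 1 + d + sum_list ds) # from_gaps ds"

lemma length_from_gaps [simp]: "length (from_gaps ds) = length ds"
  by (induction ds) auto

lemma inj_from_gaps: "inj from_gaps"
proof (rule injI)
  fix ds es assume "from_gaps ds = from_gaps es"
  then show "ds = es"
  proof (induction ds arbitrary: es)
    case Nil
    then show ?case by (cases es) auto
  next
    case (Cons d ds)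
    then obtain e es' where es: "es = e # es'" by (cases es) auto
    with Cons have "ds = es'" by auto
    with Cons.prems es show ?case by auto
  qed
qed

lemma from_gaps_less: "x \<in> set (from_gaps ds) \<Longrightarrow> x < 2 * length ds + sum_list ds"
  by (induction ds) force+

lemma range_from_gaps:
  "range from_gaps = {xs. sorted_wrt (\<lambda>x y. x \<ge> y + 2) xs \<and> (\<forall>x\<in>set xs. 0 < x)}"
  (is "_ = {xs. ?P xs}")
proof (intro equalityI subsetI)
  fix xs assume "xs \<in> range from_gaps"
  then obtain ds where "xs = from_gaps ds" by auto
  moreover have "?P (from_gaps ds)"
    by (induction ds) (auto dest!: from_gaps_less)
  ultimately show "xs \<in> {xs. ?P xs}" by simp
next
  fix xs assume "xs \<in> {xs. ?P xs}"
  then have "?P xs" by simp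
  then show "xs \<in> range from_gaps"
  proof (induction xs)
    case Nil
    have "[] = from_gaps []" by simp
    then show ?case by (rule range_eqI)
  next
    case (Cons x xs)
    then obtain ds where ds: "xs = from_gaps ds" by auto
    have "2 * length ds + 1 + sum_list ds \<le> x"
      using Cons.prems ds by (cases ds) auto
    then have "x # xs = from_gaps ((x - (2 * length ds + 1 + sum_list ds)) # ds)"
      using ds by simp
    then show ?case by (rule range_eqI)
  qed
qed

lemma sum_list_from_gaps:
  "sum_list (from_gaps ds) = (length ds)\<^sup>2 + (\<Sum>i<length ds. Suc i * ds ! i)"
proof (induction ds)
  case (Cons d ds)
  have "(\<Sum>i<length (d # ds). Suc i * (d # ds) ! i)
      = d + (\<Sum>i<length ds. Suc i * ds ! i) + (\<Sum>i<length ds. ds ! i)"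
    by (simp del: sum.lessThan_Suc add: sum.lessThan_Suc_shift sum.distrib algebra_simps)
  also have "(\<Sum>i<length ds. ds ! i) = sum_list ds"
    by (simp add: sum_list_sum_nth atLeast0LessThan)
  finally show ?case
    using Cons by (simp add: power2_eq_square)
qed simp

lemma bij_betw_from_gaps:
  "bij_betw from_gaps {ds. sum_list (from_gaps ds) = n}
     {xs \<in> partitions n. sorted_wrt (\<lambda>x y. x \<ge> y + 2) xs}"
proof (rule bij_betw_imageI)
  show "inj_on from_gaps {ds. sum_list (from_gaps ds) = n}"
    using inj_from_gaps by (rule inj_on_subset) simp
  have "from_gaps ` {ds. sum_list (from_gaps ds) = n} = {xs \<in> range from_gaps. sum_list xs = n}"
    by auto
  also have "\<dots> = {xs \<in> partitions n. sorted_wrt (\<lambda>x y. x \<ge> y + 2) xs}"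
    unfolding range_from_gaps partitions_def
    by (auto elim: sorted_wrt_mono_rel[rotated])
  finally show "from_gaps ` {ds. sum_list (from_gaps ds) = n}
    = {xs \<in> partitions n. sorted_wrt (\<lambda>x y. x \<ge> y + 2) xs}" .
qed

section \<open>Splitting the excess gaps by parity\<close>

lemma even_sum_list: "\<forall>d\<in>set ds. even d \<Longrightarrow> even (sum_list (ds :: nat list))"
  by (induction ds) auto

lemma odd_from_gaps_iff: "(\<forall>x\<in>set (from_gaps ds). odd x) \<longleftrightarrow> (\<forall>d\<in>set ds. even d)"
  by (induction ds) (auto simp: even_sum_list)

lemma from_gaps_even_image:
  "from_gaps ` {ds. \<forall>d\<in>set ds. even d} = {xs. sorted_wrt (>) xs \<and> (\<forall>x\<in>set xs. odd x)}"
proof -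
  have gap: "sorted_wrt (>) xs \<longleftrightarrow> sorted_wrt (\<lambda>x y. x \<ge> y + 2) xs"
    if "\<forall>x\<in>set xs. odd x" for xs :: "nat list"
  proof -
    have "x > y \<longleftrightarrow> x \<ge> y + 2" if "odd x" "odd y" for x y :: nat
      using that by presburger
    then show ?thesis
      using that by (induction xs) auto
  qed
  have "from_gaps ` {ds. \<forall>d\<in>set ds. even d} = {xs \<in> range from_gaps. \<forall>x\<in>set xs. odd x}"
    using odd_from_gaps_iff by auto
  also have "\<dots> = {xs. sorted_wrt (>) xs \<and> (\<forall>x\<in>set xs. odd x)}"
    unfolding range_from_gaps using gap odd_pos by blast
  finally show ?thesis .
qed

definition even_part :: "nat list \<Rightarrow> nat list" where
  "even_part ds = map (\<lambda>d. 2 * (d div 2)) ds"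

text \<open>Positions are counted from 1, so that a position is the weight with which its excess
  contributes to the sum.\<close>

definition odd_positions :: "nat list \<Rightarrow> nat set" where
  "odd_positions ds = Suc ` {i. i < length ds \<and> odd (ds ! i)}"

lemma nth_even_part:
  "i < length ds \<Longrightarrow> ds ! i = even_part ds ! i + of_bool (Suc i \<in> odd_positions ds)"
  by (auto simp: even_part_def odd_positions_def)

lemma length_even_part [simp]: "length (even_part ds) = length ds"
  by (simp add: even_part_def)

lemma even_part_even: "\<forall>d\<in>set (even_part ds). even d"
  by (simp add: even_part_def)

lemma odd_positions_subset: "odd_positions ds \<subseteq> {1..length ds}"
  by (auto simp: odd_positions_def)

text \<open>Passing to even excesses lowers \<open>d\<^sub>i\<close> by one at each odd position \<open>i\<close>, which costs
  \<open>i\<close> in the weighted sum \<open>\<Sum> i d\<^sub>i\<close>: the overlined parts make up for exactly this loss.\<close>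

lemma sum_list_from_gaps_parity:
  "sum_list (from_gaps ds) = sum_list (from_gaps (even_part ds)) + \<Sum>(odd_positions ds)"
proof -
  let ?m = "length ds" and ?b = "\<lambda>i. of_bool (Suc i \<in> odd_positions ds) :: nat"
  have "(\<Sum>i<?m. Suc i * ds ! i) = (\<Sum>i<?m. Suc i * even_part ds ! i + Suc i * ?b i)"
    by (rule sum.cong) (simp_all only: nth_even_part[of _ ds, symmetric] lessThan_iff flip: distrib_left)
  also have "\<dots> = (\<Sum>i<?m. Suc i * even_part ds ! i) + (\<Sum>i<?m. Suc i * ?b i)"
    by (rule sum.distrib)
  also have "(\<Sum>i<?m. Suc i * ?b i) = (\<Sum>i | i < ?m \<and> odd (ds ! i). Suc i)"
    by (rule sum.mono_neutral_cong_right) (auto simp: odd_positions_def)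
  also have "\<dots> = \<Sum>(odd_positions ds)"
    unfolding odd_positions_def by (simp add: sum.reindex)
  finally show ?thesis
    by (simp add: sum_list_from_gaps)
qed

lemma bij_betw_parity_lists:
  "bij_betw (\<lambda>ds. (even_part ds, odd_positions ds)) UNIV
     {(es, S). (\<forall>e\<in>set es. even e) \<and> S \<subseteq> {1..length es}}"
proof (rule bij_betw_imageI)
  show "inj (\<lambda>ds. (even_part ds, odd_positions ds))"
  proof (rule injI)
    fix ds es
    assume eq: "(even_part ds, odd_positions ds) = (even_part es, odd_positions es)"
    then have len: "length ds = length es"
      by (metis length_even_part prod.inject)
    then show "ds = es"
      using eq nth_even_part[of _ ds] nth_even_part[of _ es] by (intro nth_equalityI) simp_all
  qed
  show "range (\<lambda>ds. (even_part ds, odd_positions ds))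
      = {(es, S). (\<forall>e\<in>set es. even e) \<and> S \<subseteq> {1..length es}}" (is "range ?f = ?T")
  proof (intro equalityI subsetI)
    fix p assume "p \<in> range ?f"
    then obtain ds where "p = ?f ds" by auto
    then show "p \<in> ?T"
      using even_part_even[of ds] odd_positions_subset[of ds] by simp
  next
    fix p assume "p \<in> ?T"
    then obtain es S where p: "p = (es, S)" and es: "\<forall>e\<in>set es. even e"
      and S: "S \<subseteq> {1..length es}" by auto
    define ds where "ds = map (\<lambda>i. es ! i + of_bool (Suc i \<in> S)) [0..<length es]"
    have "even_part ds = es"
      using es by (intro nth_equalityI) (auto simp: even_part_def ds_def)
    moreover have "odd_positions ds = S"
    proof -
      have "odd_positions ds = Suc ` {i. i < length es \<and> Suc i \<in> S}"
        using es by (auto simp: odd_positions_def ds_def)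
      also have "\<dots> = S"
      proof (intro equalityI subsetI)
        fix s assume "s \<in> S"
        then show "s \<in> Suc ` {i. i < length es \<and> Suc i \<in> S}"
          using S by (intro image_eqI[of _ _ "s - 1"]) force+
      qed auto
      finally show ?thesis .
    qed
    ultimately have "p = ?f ds" using p by simp
    then show "p \<in> range ?f" by (rule range_eqI)
  qed
qed

text \<open>The meeting point of the two sides: the non-overlined parts in decreasing order together
  with the set of overlined parts.\<close>

definition odd_part_pairs :: "nat \<Rightarrow> (nat list \<times> nat set) set" where
  "odd_part_pairs n = {(xs, S). sorted_wrt (>) xs \<and> (\<forall>x\<in>set xs. odd x)
     \<and> S \<subseteq> {1..length xs} \<and> sum_list xs + \<Sum>S = n}"

text \<open>The condition \<open>S \<subseteq> {1..length xs}\<close> on overlined parts is what makes every \<open>S\<close> a set of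
  positions in the list of excesses.\<close>

lemma bij_betw_split_parity:
  "bij_betw (\<lambda>ds. (from_gaps (even_part ds), odd_positions ds))
     {ds. sum_list (from_gaps ds) = n} (odd_part_pairs n)"
    (is "bij_betw ?f ?A ?B")
proof (rule bij_betw_imageI)
  let ?g = "\<lambda>ds. (even_part ds, odd_positions ds)"
  show "inj_on ?f ?A"
  proof (rule inj_onI)
    fix ds es assume "?f ds = ?f es"
    then have "?g ds = ?g es" using inj_from_gaps by (auto dest: injD)
    then show "ds = es"
      using bij_betw_parity_lists by (auto simp: bij_betw_def dest: injD)
  qed
  show "?f ` ?A = ?B"
  proof (intro equalityI subsetI)
    fix p assume "p \<in> ?f ` ?A"
    then obtain ds where p: "p = ?f ds" and sum: "sum_list (from_gaps ds) = n" by auto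
    have "from_gaps (even_part ds) \<in> from_gaps ` {ds. \<forall>d\<in>set ds. even d}"
      using even_part_even by blast
    then show "p \<in> ?B"
      using p sum odd_positions_subset[of ds] sum_list_from_gaps_parity[of ds]
      by (simp add: from_gaps_even_image odd_part_pairs_def)
  next
    fix p assume "p \<in> ?B"
    then obtain xs S where p: "p = (xs, S)" "sorted_wrt (>) xs" "\<forall>x\<in>set xs. odd x"
      "S \<subseteq> {1..length xs}" "sum_list xs + \<Sum>S = n" by (auto simp: odd_part_pairs_def)
    then have "xs \<in> from_gaps ` {es. \<forall>e\<in>set es. even e}"
      by (simp add: from_gaps_even_image)
    then obtain es where es: "xs = from_gaps es" "\<forall>e\<in>set es. even e"
      by auto
    then have "(es, S) \<in> range ?g"
      unfolding bij_betw_imp_surj_on[OF bij_betw_parity_lists] using p(4) by simp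
    then obtain ds where "(es, S) = ?g ds" by blast
    then show "p \<in> ?f ` ?A"
      using p es sum_list_from_gaps_parity[of ds] by (intro image_eqI[of _ _ ds]) auto
  qed
qed

section \<open>Overpartitions as pairs of their non-overlined and overlined parts\<close>

text \<open>In an overpartition whose non-overlined parts are distinct, a magnitude
  occurs at most twice, and if it does, then first without and next with an overline. The two
  order conditions on such an overpartition therefore say that this injective numbering of its
  parts is strictly decreasing, so the overpartition is determined by its set of parts.\<close>

definition key :: "opart \<Rightarrow> nat" where
  "key p = 2 * fst p + of_bool (\<not> snd p)"

lemma inj_key: "inj key"
proof (rule injI)
  fix p q assume eq: "key p = key q"
  then have "even (key p) \<longleftrightarrow> even (key q)" by simp
  then have "snd p = snd q"
    by (cases "snd p"; cases "snd q") (simp_all add: key_def)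
  with eq show "p = q" by (auto simp: key_def prod_eq_iff)
qed

lemma key_less_iff: "key q < key p \<longleftrightarrow> fst q < fst p \<or> (fst q = fst p \<and> snd q \<and> \<not> snd p)"
  by (auto simp: key_def)

lemma strictly_decreasing_unique:
  assumes "sorted_wrt (>) xs" "sorted_wrt (>) ys" "set xs = set (ys :: 'a :: linorder list)"
  shows "xs = ys"
  using strict_sorted_equal[of "rev xs" "rev ys"] assms by (simp add: sorted_wrt_rev)

lemma sorted_wrt_map_filter: "sorted_wrt R (map f (filter P xs))
    \<longleftrightarrow> sorted_wrt (\<lambda>x y. P x \<longrightarrow> P y \<longrightarrow> R (f x) (f y)) xs"
  by (induction xs) auto

lemma sorted_wrt_conj:
  "sorted_wrt (\<lambda>x y. P x y \<and> Q x y) xs \<longleftrightarrow> sorted_wrt P xs \<and> sorted_wrt Q xs"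
  by (induction xs) auto

lemma distinct_iff_sorted_wrt: "distinct xs \<longleftrightarrow> sorted_wrt (\<noteq>) xs"
  by (induction xs) auto

lemma overpartition_iff_key_decreasing:
  "sorted_wrt (\<lambda>p q. fst p \<ge> fst q) ps \<and> sorted_wrt (\<lambda>p q. snd p \<longrightarrow> fst p \<noteq> fst q) ps
      \<and> distinct (non_overlined ps)
    \<longleftrightarrow> sorted_wrt (\<lambda>p q. key p > key q) ps"
proof -
  have "(\<lambda>p q. fst q \<le> fst p \<and> (snd p \<longrightarrow> fst p \<noteq> fst q)
        \<and> (\<not> snd p \<longrightarrow> \<not> snd q \<longrightarrow> fst p \<noteq> fst q)) = (\<lambda>p q. key p > key q)"
    by (intro ext) (auto simp: key_less_iff)
  then show ?thesis
    unfolding non_overlined_def distinct_iff_sorted_wrt sorted_wrt_map_filter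
    by (simp flip: sorted_wrt_conj)
qed

lemma key_decreasing_unique:
  assumes "sorted_wrt (\<lambda>p q. key p > key q) ps" "sorted_wrt (\<lambda>p q. key p > key q) qs"
    and "set ps = set qs"
  shows "ps = qs"
proof -
  have "map key ps = map key qs"
    using assms by (intro strictly_decreasing_unique) (auto simp: sorted_wrt_map)
  then show ?thesis
    using inj_key by (auto simp: inj_map_eq_map)
qed

lemma key_decreasing_exists:
  assumes "finite A"
  obtains ps where "sorted_wrt (\<lambda>p q. key p > key q) ps" "set ps = A"
proof
  let ?ks = "sorted_list_of_set (key ` A)"
  let ?ps = "rev (map (inv key) ?ks)"
  have A: "finite (key ` A)" and inv: "map key (map (inv key) ?ks) = ?ks"
    using assms by (auto intro!: map_idI simp: f_inv_into_f)
  show "set ?ps = A"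
    using A inj_key by (simp add: image_image)
  have "sorted_wrt (<) (map key (map (inv key) ?ks))"
    unfolding inv by simp
  then show "sorted_wrt (\<lambda>p q. key p > key q) ?ps"
    by (simp add: sorted_wrt_map sorted_wrt_rev)
qed

lemma set_non_overlined: "set (non_overlined ps) = {x. (x, False) \<in> set ps}"
  by (force simp: non_overlined_def)

lemma set_overlined: "set (overlined ps) = {x. (x, True) \<in> set ps}"
  by (force simp: overlined_def)

lemma set_eq_overlined_non_overlined:
  "set ps = (\<lambda>x. (x, False)) ` set (non_overlined ps) \<union> (\<lambda>x. (x, True)) ` set (overlined ps)"
  by (force simp: non_overlined_def overlined_def)

lemma sum_list_overlined_non_overlined:
  "sum_list (map fst ps) = sum_list (non_overlined ps) + sum_list (overlined ps)"
  by (induction ps) (auto simp: non_overlined_def overlined_def)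

lemma key_decreasing_non_overlined:
  "sorted_wrt (\<lambda>p q. key p > key q) ps \<Longrightarrow> sorted_wrt (>) (non_overlined ps)"
  unfolding non_overlined_def sorted_wrt_map_filter
  by (erule sorted_wrt_mono_rel[rotated]) (auto simp: key_less_iff)

lemma key_decreasing_distinct_overlined:
  "sorted_wrt (\<lambda>p q. key p > key q) ps \<Longrightarrow> distinct (overlined ps)"
  unfolding overlined_def distinct_iff_sorted_wrt sorted_wrt_map_filter
  by (erule sorted_wrt_mono_rel[rotated]) (auto simp: key_less_iff)

lemma restricted_overpartition_iff:
  "ps \<in> overpartitions n \<and> (\<forall>x\<in>set (non_overlined ps). odd x) \<and> distinct (non_overlined ps)
      \<and> (\<forall>x\<in>set (overlined ps). x \<le> length (non_overlined ps))
    \<longleftrightarrow> sorted_wrt (\<lambda>p q. key p > key q) ps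
      \<and> (non_overlined ps, set (overlined ps)) \<in> odd_part_pairs n" (is "?L \<longleftrightarrow> ?R")
proof -
  have pos: "(\<forall>p\<in>set ps. 0 < fst p)
      \<longleftrightarrow> (\<forall>x\<in>set (non_overlined ps). 0 < x) \<and> (\<forall>x\<in>set (overlined ps). 0 < x)"
    by (subst set_eq_overlined_non_overlined) (simp add: ball_Un)
  have sum: "sum_list (map fst ps) = sum_list (non_overlined ps) + \<Sum>(set (overlined ps))"
    if "sorted_wrt (\<lambda>p q. key p > key q) ps"
    using key_decreasing_distinct_overlined[OF that]
    by (simp add: sum_list_overlined_non_overlined distinct_sum_list_conv_Sum)
  have "?L \<longleftrightarrow> sorted_wrt (\<lambda>p q. key p > key q) ps \<and> (\<forall>p\<in>set ps. 0 < fst p)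
      \<and> sum_list (map fst ps) = n \<and> (\<forall>x\<in>set (non_overlined ps). odd x)
      \<and> (\<forall>x\<in>set (overlined ps). x \<le> length (non_overlined ps))"
    unfolding overpartitions_def overpartition_iff_key_decreasing[symmetric] by blast
  also have "\<dots> \<longleftrightarrow> ?R"
    unfolding odd_part_pairs_def pos
    using sum key_decreasing_non_overlined by (auto simp: subset_iff Suc_le_eq odd_pos)
  finally show ?thesis .
qed

lemma bij_betw_split_overpartition:
  "bij_betw (\<lambda>ps. (non_overlined ps, set (overlined ps)))
     {ps \<in> overpartitions n. (\<forall>x\<in>set (non_overlined ps). odd x) \<and> distinct (non_overlined ps)
        \<and> (\<forall>x\<in>set (overlined ps). x \<le> length (non_overlined ps))}
     (odd_part_pairs n)" (is "bij_betw ?f ?A ?B")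
  unfolding restricted_overpartition_iff
proof (rule bij_betw_imageI)
  let ?A = "{ps. sorted_wrt (\<lambda>p q. key p > key q) ps \<and> ?f ps \<in> ?B}"
  show "inj_on ?f ?A"
  proof (rule inj_onI)
    fix ps qs assume "ps \<in> ?A" "qs \<in> ?A" "?f ps = ?f qs"
    then show "ps = qs"
      using set_eq_overlined_non_overlined[of ps] set_eq_overlined_non_overlined[of qs]
      by (intro key_decreasing_unique) auto
  qed
  show "?f ` ?A = ?B"
  proof (intro equalityI subsetI)
    fix p assume p: "p \<in> ?B"
    then obtain xs S where xs: "p = (xs, S)" "sorted_wrt (>) xs" "S \<subseteq> {1..length xs}"
      by (auto simp: odd_part_pairs_def)
    have "finite S"
      by (rule finite_subset[OF xs(3)]) simp
    then have "finite ((\<lambda>x. (x, False)) ` set xs \<union> (\<lambda>x. (x, True)) ` S)"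
      by simp
    then obtain ps where ps: "sorted_wrt (\<lambda>p q. key p > key q) ps"
      "set ps = (\<lambda>x. (x, False)) ` set xs \<union> (\<lambda>x. (x, True)) ` S"
      by (rule key_decreasing_exists)
    have "set (non_overlined ps) = set xs"
      unfolding set_non_overlined ps(2) by auto
    then have "non_overlined ps = xs"
      by (rule strictly_decreasing_unique[OF key_decreasing_non_overlined[OF ps(1)] xs(2)])
    moreover have "set (overlined ps) = S"
      unfolding set_overlined ps(2) by auto
    ultimately show "p \<in> ?f ` ?A"
      using p xs ps(1) by (intro image_eqI[of _ _ ps]) auto
  qed auto
qed

theorem theorem3p1:
  fixes n :: nat
  shows "RR1 n = RR1_bar n"
proof -
  have "RR1 n = card {ds. sum_list (from_gaps ds) = n}"
    unfolding RR1_def by (rule bij_betw_same_card[OF bij_betw_from_gaps, symmetric])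
  also have "\<dots> = card (odd_part_pairs n)"
    by (rule bij_betw_same_card[OF bij_betw_split_parity])
  also have "\<dots> = RR1_bar n"
    unfolding RR1_bar_def by (rule bij_betw_same_card[OF bij_betw_split_overpartition, symmetric])
  finally show ?thesis .
qed

end
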